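(* Let $S$ be the Sierpi\'nski triangle. Then $\dim_{tH}S=1$.
   Context: The Sierpi\'nski triangle $S\subseteq\mathbb{R}^2$ is the unique non-empty compact set with $S=\bigcup_{i=1}^3\varphi_i(S)$, where $\varphi_i(x)=\frac12(x+v_i)$ and $v_1,v_2,v_3$ are the vertices of an equilateral triangle; it carries the Euclidean metric. $\dim_H$ denotes Hausdorff dimension, with the convention $\dim_H\emptyset=-1$. The topological Hausdorff dimension is defined by $\dim_{tH}\emptyset=-1$ and, for a non-empty metric space $X$, $\dim_{tH}X=\inf\{d: X \text{ has a basis } \mathcal U \text{ of open sets such that } \dim_H\partial U\le d-1 \text{ for every } U\in\mathcal U\}$ (where $d=\infty$ is allowed, with $\infty-1=\infty$). *)

theory Defs
  imports "HOL-Analysis.Analysis"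
begin

text \<open>
  \<open>diam_pow s U\<close> is $(\mathrm{diam}\, U)^s$, with $(\mathrm{diam}\,\emptyset)^s = 0$ for all \<open>s\<close>
  and $(\mathrm{diam}\, U)^0 = 1$ for non-empty \<open>U\<close>, so that the measure for \<open>s = 0\<close> counts
  points. The case distinctions are needed because \<open>0 powr 0 = 0\<close>. Only meaningful for
  bounded \<open>U\<close>, since \<^const>\<open>diameter\<close> is real-valued.
\<close>

definition diam_pow :: "real \<Rightarrow> 'a::metric_space set \<Rightarrow> ennreal" where
  "diam_pow s U = (if U = {} then 0 else if s = 0 then 1 else ennreal (diameter U powr s))"

definition hausdorff_premeasure :: "real \<Rightarrow> real \<Rightarrow> 'a::metric_space set \<Rightarrow> ennreal" where
  "hausdorff_premeasure s \<delta> A =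
     (INF U \<in> {U :: nat \<Rightarrow> 'a set. A \<subseteq> (\<Union>i. U i) \<and> (\<forall>i. bounded (U i) \<and> diameter (U i) \<le> \<delta>)}.
        \<Sum>i. diam_pow s (U i))"

definition hausdorff_measure :: "real \<Rightarrow> 'a::metric_space set \<Rightarrow> ennreal" where
  "hausdorff_measure s A = (SUP \<delta> \<in> {0<..}. hausdorff_premeasure s \<delta> A)"

text \<open>If no \<open>s\<close> qualifies, the infimum of the empty set is \<open>\<infinity>\<close>.\<close>

definition hausdorff_dim :: "'a::metric_space set \<Rightarrow> ereal" where
  "hausdorff_dim A =
     (if A = {} then -1 else Inf {ereal s |s. 0 \<le> s \<and> hausdorff_measure s A < \<infinity>})"

text \<open>The analogue of \<^const>\<open>topological_basis\<close> for a topology given as an object.\<close>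

definition basis_of_topology :: "'a topology \<Rightarrow> 'a set set \<Rightarrow> bool" where
  "basis_of_topology T \<U> \<longleftrightarrow>
     (\<forall>U\<in>\<U>. openin T U) \<and> (\<forall>V. openin T V \<longrightarrow> (\<exists>\<V>\<subseteq>\<U>. \<Union>\<V> = V))"

text \<open>
  The set \<open>X\<close> is regarded as a metric space in its own right: openness and boundaries are taken
  relative to \<open>X\<close>. The infimum ranges over extended reals \<open>d\<close>, with \<open>\<infinity> - 1 = \<infinity>\<close>. Values
  \<open>d < 0\<close> never contribute, as \<^const>\<open>hausdorff_dim\<close> is at least \<open>-1\<close>.
\<close>

definition topological_hausdorff_dim :: "'a::metric_space set \<Rightarrow> ereal" where
  "topological_hausdorff_dim X =
     (if X = {} then -1
      else Inf {d. \<exists>\<U>. basis_of_topology (top_of_set X) \<U> \<and>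
                     (\<forall>U\<in>\<U>. hausdorff_dim (top_of_set X frontier_of U) \<le> d - 1)})"

definition sierpinski_map :: "'a::real_normed_vector \<Rightarrow> 'a \<Rightarrow> 'a" where
  "sierpinski_map v x = (1/2) *\<^sub>R (x + v)"

definition is_sierpinski_attractor :: "'a::real_normed_vector set \<Rightarrow> 'a set \<Rightarrow> bool" where
  "is_sierpinski_attractor V S \<longleftrightarrow>
     S \<noteq> {} \<and> compact S \<and> S = (\<Union>v\<in>V. sierpinski_map v ` S)"

definition sierpinski_triangle :: "real^2 \<Rightarrow> real^2 \<Rightarrow> real^2 \<Rightarrow> (real^2) set" where
  "sierpinski_triangle v1 v2 v3 = (THE S. is_sierpinski_attractor {v1, v2, v3} S)"

text \<open>Existence and uniqueness of the attractor, so that the definite description is meaningful.\<close>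

lemma dist_sierpinski_map: "dist (sierpinski_map v x) (sierpinski_map v y) = dist x y / 2"
  unfolding sierpinski_map_def dist_norm
  by (simp flip: scaleR_diff_right)

lemma continuous_on_sierpinski_map: "continuous_on A (sierpinski_map v)"
  unfolding sierpinski_map_def by (intro continuous_intros)

lemma sierpinski_attractor_exists:
  fixes V :: "'a::euclidean_space set"
  assumes "finite V" "V \<noteq> {}"
  shows "\<exists>S. is_sierpinski_attractor V S"
proof -
  define F where "F A = (\<Union>v\<in>V. sierpinski_map v ` A)" for A
  have F_mono: "F A \<subseteq> F B" if "A \<subseteq> B" for A B
    using that by (auto simp: F_def)
  obtain r where r: "\<And>v. v \<in> V \<Longrightarrow> norm v \<le> r"
    using finite_imp_bounded[OF assms(1)] by (auto simp: bounded_iff)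
  define K where "K = cball (0::'a) r"
  have FK: "F K \<subseteq> K"
  proof
    fix y assume "y \<in> F K"
    then obtain v x where v: "v \<in> V" "norm x \<le> r" "y = sierpinski_map v x"
      by (auto simp: F_def K_def)
    have "norm y = norm (x + v) / 2"
      using v(3) by (simp add: sierpinski_map_def)
    also have "\<dots> \<le> r"
      using norm_triangle_ineq[of x v] r[OF v(1)] v(2) by linarith
    finally show "y \<in> K" by (simp add: K_def)
  qed
  define S where "S = \<Union>{A. A \<subseteq> K \<and> A \<subseteq> F A}"
  have upper: "A \<subseteq> S" if "A \<subseteq> K" "A \<subseteq> F A" for A
    using that by (auto simp: S_def)
  have SK: "S \<subseteq> K" by (auto simp: S_def)
  have S_post: "S \<subseteq> F S"
  proof
    fix x assume "x \<in> S"
    then obtain A where A: "x \<in> A" "A \<subseteq> K" "A \<subseteq> F A" by (auto simp: S_def)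
    then show "x \<in> F S" using F_mono[OF upper[OF A(2,3)]] by blast
  qed
  have "F S \<subseteq> S"
    using F_mono[OF SK] FK F_mono[OF S_post] by (intro upper) auto
  with S_post have fix_S: "S = F S" by auto
  have clK: "closure S \<subseteq> K"
    using SK by (simp add: K_def closure_minimal)
  then have "compact (closure S)"
    using SK bounded_subset[of K S] by (simp add: K_def compact_closure)
  then have "compact (F (closure S))"
    unfolding F_def using assms(1)
    by (intro compact_UN compact_continuous_image continuous_on_sierpinski_map)
  then have "closure S \<subseteq> F (closure S)"
    using S_post F_mono[OF closure_subset[of S]]
    by (meson closure_minimal compact_imp_closed order_trans)
  then have "closure S \<subseteq> S" using clK by (intro upper)
  then have compact_S: "compact S"
    using \<open>compact (closure S)\<close> closure_subset[of S] by (simp add: subset_antisym)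
  obtain v where v: "v \<in> V" using assms(2) by auto
  have "sierpinski_map v v = v"
    by (simp add: sierpinski_map_def flip: scaleR_2)
  then have "v \<in> F {v}" using v by (force simp: F_def)
  then have "{v} \<subseteq> S" using r[OF v] by (intro upper) (auto simp: K_def)
  then show ?thesis
    using compact_S fix_S unfolding is_sierpinski_attractor_def F_def by auto
qed

lemma sierpinski_attractor_subset:
  fixes V :: "'a::euclidean_space set"
  assumes "is_sierpinski_attractor V A" "is_sierpinski_attractor V B"
  shows "A \<subseteq> B"
proof -
  have A: "A \<noteq> {}" "compact A" "A = (\<Union>v\<in>V. sierpinski_map v ` A)"
    and B: "B \<noteq> {}" "compact B" "B = (\<Union>v\<in>V. sierpinski_map v ` B)"
    using assms unfolding is_sierpinski_attractor_def by blast+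
  obtain a where a: "a \<in> A" "\<And>y. y \<in> A \<Longrightarrow> infdist y B \<le> infdist a B"
    using continuous_attains_sup[OF A(2,1) continuous_on_infdist[OF continuous_on_id]]
    by blast
  obtain v a' where v: "v \<in> V" "a' \<in> A" "a = sierpinski_map v a'"
    using a(1) A(3) by blast
  obtain b where b: "b \<in> B" "infdist a' B = dist a' b"
    using infdist_attains_inf[OF compact_imp_closed[OF B(2)] B(1)] by blast
  have "sierpinski_map v b \<in> B" using b(1) v(1) B(3) by blast
  then have "infdist a B \<le> infdist a' B / 2"
    using infdist_le[of "sierpinski_map v b" B a] by (simp add: v(3) dist_sierpinski_map b(2))
  with a(2)[OF v(2)] have "infdist a B \<le> 0" by linarith
  then have "infdist y B = 0" if "y \<in> A" for y
    using a(2)[OF that] infdist_nonneg[of y B] by linarith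
  then show ?thesis
    using in_closed_iff_infdist_zero[OF compact_imp_closed[OF B(2)] B(1)] by blast
qed

lemma sierpinski_attractor_ex1:
  fixes V :: "'a::euclidean_space set"
  assumes "finite V" "V \<noteq> {}"
  shows "\<exists>!S. is_sierpinski_attractor V S"
  using sierpinski_attractor_exists[OF assms]
  by (rule ex_ex1I) (rule subset_antisym; rule sierpinski_attractor_subset; assumption)

lemma sierpinski_triangle_attractor:
  "is_sierpinski_attractor {v1, v2, v3} (sierpinski_triangle v1 v2 v3)"
  unfolding sierpinski_triangle_def
  by (rule theI') (intro sierpinski_attractor_ex1; simp)

end

(* For every n the triangle is a finite union of compact cells of diameter O(2^-n), any two of which
   meet in finitely many points. Removing from S all n-cells that do not contain a point x leaves a
   neighbourhood of x whose boundary lies in the intersections of distinct cells, hence is finite.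
   Conversely S contains the segment from v1 to v2, which meets the boundary of every set that
   separates v1 from v2. *)
theory Submission
  imports Defs
begin

section \<open>Hausdorff dimension of finite sets, and criteria for topological Hausdorff dimension
  1\<close>

lemma hausdorff_dim_nonneg:
  assumes "A \<noteq> {}"
  shows "0 \<le> hausdorff_dim A"
  using assms by (auto simp: hausdorff_dim_def intro!: Inf_greatest)

text \<open>Singletons have diameter 0, so covering the set by its points is admissible for every
  \<open>\<delta>\<close> and costs 1 per point.\<close>

lemma hausdorff_measure_0_finite_le_card:
  assumes "finite A"
  shows "hausdorff_measure 0 A \<le> ennreal (card A)"
  unfolding hausdorff_measure_def
proof (rule SUP_least)
  fix \<delta> :: real assume "\<delta> \<in> {0<..}"
  obtain f where f: "bij_betw f {..<card A} A"
    using ex_bij_betw_nat_finite[OF assms] by (auto simp: atLeast0LessThan)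
  \<comment> \<open>Covers are infinite sequences; padding with \<open>{}\<close> is free because
    \<open>diam_pow\<close> of the empty set is 0 even for exponent 0.\<close>
  define U where "U i = (if i < card A then {f i} else {})" for i
  have "A \<subseteq> (\<Union>i. U i)"
    using f by (force simp: U_def bij_betw_def)
  then have "hausdorff_premeasure 0 \<delta> A \<le> (\<Sum>i. diam_pow 0 (U i))"
    using \<open>\<delta> \<in> {0<..}\<close> unfolding hausdorff_premeasure_def
    by (intro INF_lower) (auto simp: U_def)
  also have "\<dots> = (\<Sum>i<card A. diam_pow 0 (U i))"
    by (intro suminf_finite) (auto simp: U_def diam_pow_def)
  also have "\<dots> = ennreal (card A)"
    by (simp add: U_def diam_pow_def ennreal_of_nat_eq_real_of_nat)
  finally show "hausdorff_premeasure 0 \<delta> A \<le> ennreal (card A)" .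
qed

lemma hausdorff_dim_finite_le_0:
  assumes "finite A"
  shows "hausdorff_dim A \<le> 0"
proof (cases "A = {}")
  case False
  have "hausdorff_measure 0 A < \<infinity>"
    using hausdorff_measure_0_finite_le_card[OF assms] le_less_trans by fastforce
  then have "Inf {ereal s |s. 0 \<le> s \<and> hausdorff_measure s A < \<infinity>} \<le> ereal 0"
    by (intro Inf_lower) auto
  with False show ?thesis by (simp add: hausdorff_dim_def zero_ereal_def)
qed (simp add: hausdorff_dim_def)

text \<open>A connected set meets the frontier of any set that contains one of its points and misses
  another. A non-empty frontier has dimension at least 0, which forces \<open>d - 1\<close> to be at
  least 0.\<close>

lemma topological_hausdorff_dim_ge_1:
  fixes X K :: "'a::metric_space set"
  assumes "connected K" "K \<subseteq> X" "a \<in> K" "b \<in> K" "a \<noteq> b"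
  shows "1 \<le> topological_hausdorff_dim X"
proof -
  have "1 \<le> d" if \<U>: "basis_of_topology (top_of_set X) \<U>"
    and d: "\<forall>U\<in>\<U>. hausdorff_dim (top_of_set X frontier_of U) \<le> d - 1" for d \<U>
  proof -
    \<comment> \<open>Removing \<open>b\<close> from \<open>X\<close> leaves an open set around
      \<open>a\<close>, so some basis member contains \<open>a\<close> but not
      \<open>b\<close>.\<close>
    have "openin (top_of_set X) (X \<inter> - {b})"
      by (intro openin_open_Int) auto
    then obtain \<V> where \<V>: "\<V> \<subseteq> \<U>" "\<Union>\<V> = X \<inter> - {b}"
      using \<U> unfolding basis_of_topology_def by metis
    have "a \<in> \<Union>\<V>" using assms by (auto simp: \<V>(2))
    then obtain U where U: "U \<in> \<U>" "a \<in> U" "b \<notin> U"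
      using \<V> by blast
    have "connectedin (top_of_set X) K"
      using assms by (simp add: connectedin_subtopology)
    then have "K \<inter> (top_of_set X frontier_of U) \<noteq> {}"
      by (rule connectedin_Int_frontier_of) (use assms U in auto)
    then have "0 \<le> hausdorff_dim (top_of_set X frontier_of U)"
      by (intro hausdorff_dim_nonneg) auto
    also have "\<dots> \<le> d - 1" using d U by blast
    finally show "1 \<le> d"
      by (cases d) (auto simp: one_ereal_def zero_ereal_def)
  qed
  then show ?thesis
    using assms by (auto simp: topological_hausdorff_dim_def intro!: Inf_greatest)
qed

text \<open>The hypothesis makes the relatively open sets with finite frontier a basis, and finite
  sets have Hausdorff dimension at most 0.\<close>

lemma topological_hausdorff_dim_le_1:
  fixes X :: "'a::metric_space set"
  assumes "\<And>x e. x \<in> X \<Longrightarrow> 0 < e \<Longrightarrow>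
    \<exists>U. openin (top_of_set X) U \<and> x \<in> U \<and> U \<subseteq> ball x e \<and> finite (top_of_set X frontier_of U)"
  shows "topological_hausdorff_dim X \<le> 1"
proof (cases "X = {}")
  case False
  define \<U> where "\<U> = {U. openin (top_of_set X) U \<and> finite (top_of_set X frontier_of U)}"
  have "\<exists>\<V>\<subseteq>\<U>. \<Union>\<V> = V" if V: "openin (top_of_set X) V" for V
  proof (intro exI conjI)
    show "\<Union>{U\<in>\<U>. U \<subseteq> V} = V"
    proof
      show "V \<subseteq> \<Union>{U\<in>\<U>. U \<subseteq> V}"
      proof
        fix x assume "x \<in> V"
        with V obtain e where e: "0 < e" "ball x e \<inter> X \<subseteq> V" and "x \<in> X"
          by (metis openin_contains_ball subsetD)
        then obtain U where "openin (top_of_set X) U" "x \<in> U" "U \<subseteq> ball x e"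
          "finite (top_of_set X frontier_of U)"
          using assms by blast
        moreover from this e have "U \<subseteq> V"
          using openin_imp_subset by fastforce
        ultimately show "x \<in> \<Union>{U\<in>\<U>. U \<subseteq> V}" by (auto simp: \<U>_def)
      qed
    qed auto
  qed auto
  then have "basis_of_topology (top_of_set X) \<U>"
    by (auto simp: basis_of_topology_def \<U>_def)
  moreover have "\<forall>U\<in>\<U>. hausdorff_dim (top_of_set X frontier_of U) \<le> 1 - 1"
    using hausdorff_dim_finite_le_0 by (auto simp: \<U>_def one_ereal_def)
  ultimately show ?thesis
    using False by (auto simp: topological_hausdorff_dim_def intro!: Inf_lower)
qed (simp add: topological_hausdorff_dim_def one_ereal_def)

section \<open>A segment inside the attractor\<close>

text \<open>Take a point of \<open>A\<close> farthest from \<open>S\<close>. It is the image of a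
  point of \<open>A\<close> at least twice as far away, so the maximal distance is 0. The one-sided
  inclusion suffices, so this applies to an edge of the triangle.\<close>

lemma compact_subset_sierpinski_attractor:
  fixes V :: "'a::real_normed_vector set"
  assumes "is_sierpinski_attractor V S" "compact A" "A \<subseteq> (\<Union>v\<in>V. sierpinski_map v ` A)"
  shows "A \<subseteq> S"
proof (cases "A = {}")
  case False
  have S: "S \<noteq> {}" "compact S" "S = (\<Union>v\<in>V. sierpinski_map v ` S)"
    using assms(1) unfolding is_sierpinski_attractor_def by blast+
  obtain a where a: "a \<in> A" "\<And>y. y \<in> A \<Longrightarrow> infdist y S \<le> infdist a S"
    using continuous_attains_sup[OF assms(2) False continuous_on_infdist[OF continuous_on_id]]
    by blast
  obtain v a' where v: "v \<in> V" "a' \<in> A" "a = sierpinski_map v a'"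
    using a(1) assms(3) by blast
  \<comment> \<open>The map for \<open>v\<close> sends \<open>S\<close> into itself and halves
    distances, so each \<open>b\<close> in \<open>S\<close> yields a point of \<open>S\<close> at
    distance \<open>dist a' b / 2\<close> from \<open>a\<close>.\<close>
  have "2 * infdist a S \<le> infdist a' S"
    unfolding infdist_notempty[OF S(1), of a']
  proof (rule cINF_greatest[OF S(1)])
    fix b assume "b \<in> S"
    then have "sierpinski_map v b \<in> S" using v(1) S(3) by blast
    from infdist_le[OF this, of a] show "2 * infdist a S \<le> dist a' b"
      by (simp add: v(3) dist_sierpinski_map)
  qed
  with a(2)[OF v(2)] have "infdist a S \<le> 0" by linarith
  then have "infdist y S = 0" if "y \<in> A" for y
    using a(2)[OF that] infdist_nonneg[of y S] by linarith
  then show ?thesis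
    using in_closed_iff_infdist_zero[OF compact_imp_closed[OF S(2)] S(1)] by blast
qed simp

lemma closed_segment_subset_sierpinski_maps:
  "closed_segment v w \<subseteq> sierpinski_map v ` closed_segment v w \<union> sierpinski_map w ` closed_segment v w"
proof
  fix x assume "x \<in> closed_segment v w"
  then obtain u where u: "0 \<le> u" "u \<le> 1" "x = (1 - u) *\<^sub>R v + u *\<^sub>R w"
    by (auto simp: in_segment)
  show "x \<in> sierpinski_map v ` closed_segment v w \<union> sierpinski_map w ` closed_segment v w"
  \<comment> \<open>The half of the segment nearer to \<open>v\<close> is its image under the map
    fixing \<open>v\<close>, the other half its image under the map fixing \<open>w\<close>; the
    preimages have parameters \<open>2 * u\<close> and \<open>2 * u - 1\<close>.\<close>
  proof (cases "u \<le> 1/2")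
    case True
    have "x = sierpinski_map v ((1 - 2 * u) *\<^sub>R v + (2 * u) *\<^sub>R w)"
      by (simp add: u(3) sierpinski_map_def algebra_simps flip: scaleR_2 scaleR_add_left)
    moreover have "(1 - 2 * u) *\<^sub>R v + (2 * u) *\<^sub>R w \<in> closed_segment v w"
      using u True by (auto simp: in_segment intro!: exI[of _ "2 * u"])
    ultimately show ?thesis by blast
  next
    case False
    have "x = sierpinski_map w ((1 - (2 * u - 1)) *\<^sub>R v + (2 * u - 1) *\<^sub>R w)"
      by (simp add: u(3) sierpinski_map_def algebra_simps flip: scaleR_2 scaleR_add_left)
    moreover have "(1 - (2 * u - 1)) *\<^sub>R v + (2 * u - 1) *\<^sub>R w \<in> closed_segment v w"
      using u False by (auto simp: in_segment intro!: exI[of _ "2 * u - 1"])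
    ultimately show ?thesis by blast
  qed
qed

section \<open>Cells of level n and neighbourhoods with finite frontier\<close>

lemma sierpinski_attractor_cells:
  fixes V :: "'a::real_normed_vector set"
  assumes "is_sierpinski_attractor V S" "finite V"
    and fin: "pairwise (\<lambda>v w. finite (sierpinski_map v ` S \<inter> sierpinski_map w ` S)) V"
  shows "\<exists>\<C>. finite \<C> \<and> \<Union>\<C> = S \<and> (\<forall>C\<in>\<C>. compact C) \<and>
    (\<forall>C\<in>\<C>. \<forall>x\<in>C. \<forall>y\<in>C. dist x y \<le> diameter S / 2 ^ n) \<and>
    pairwise (\<lambda>C C'. finite (C \<inter> C')) \<C>"
proof (induction n)
  case 0
  have "compact S" using assms(1) by (simp add: is_sierpinski_attractor_def)
  then show ?case
    by (intro exI[of _ "{S}"]) (auto intro: diameter_bounded_bound compact_imp_bounded)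
next
  case (Suc n)
  then obtain \<C> where \<C>: "finite \<C>" "\<Union>\<C> = S" "\<And>C. C \<in> \<C> \<Longrightarrow> compact C"
    "\<And>C x y. C \<in> \<C> \<Longrightarrow> x \<in> C \<Longrightarrow> y \<in> C \<Longrightarrow> dist x y \<le> diameter S / 2 ^ n"
    "pairwise (\<lambda>C C'. finite (C \<inter> C')) \<C>"
    by metis
  \<comment> \<open>The new map is applied outermost. Cells with the same outer map then meet in an
    image of an intersection from the previous level, and cells with different outer maps meet
    inside an intersection of first-level cells.\<close>
  define \<D> where "\<D> = (\<lambda>(v, C). sierpinski_map v ` C) ` (V \<times> \<C>)"
  have "S = (\<Union>v\<in>V. sierpinski_map v ` S)"
    using assms(1) unfolding is_sierpinski_attractor_def by blast
  moreover have "\<Union>\<D> = (\<Union>v\<in>V. sierpinski_map v ` \<Union>\<C>)"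
    by (auto simp: \<D>_def)
  ultimately have "\<Union>\<D> = S" by (simp add: \<C>(2))
  moreover have "finite \<D>" using assms \<C>(1) by (simp add: \<D>_def)
  moreover have "compact D" if "D \<in> \<D>" for D
    using that \<C>(3) by (auto simp: \<D>_def intro!: compact_continuous_image continuous_on_sierpinski_map)
  moreover have "dist x y \<le> diameter S / 2 ^ Suc n" if "D \<in> \<D>" "x \<in> D" "y \<in> D" for D x y
  proof -
    obtain v C x' y' where "C \<in> \<C>" "x' \<in> C" "y' \<in> C" "x = sierpinski_map v x'" "y = sierpinski_map v y'"
      using \<open>x \<in> D\<close> \<open>y \<in> D\<close> \<open>D \<in> \<D>\<close> by (auto simp: \<D>_def)
    then show ?thesis
      using \<C>(4)[of C x' y'] by (simp add: dist_sierpinski_map)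
  qed
  moreover have "pairwise (\<lambda>D D'. finite (D \<inter> D')) \<D>"
  proof (rule pairwiseI)
    fix D D' assume that: "D \<in> \<D>" "D' \<in> \<D>" "D \<noteq> D'"
    then obtain v C w C' where D: "v \<in> V" "w \<in> V" "C \<in> \<C>" "C' \<in> \<C>"
      "D = sierpinski_map v ` C" "D' = sierpinski_map w ` C'"
      unfolding \<D>_def by blast
    show "finite (D \<inter> D')"
    proof (cases "v = w")
      case True
      have "inj (sierpinski_map v)"
        by (auto simp: inj_on_def sierpinski_map_def)
      then have "D \<inter> D' = sierpinski_map v ` (C \<inter> C')"
        using True D by (simp add: image_Int)
      moreover have "C \<noteq> C'" using that(3) D(5,6) True by blast
      ultimately show ?thesis using pairwiseD[OF \<C>(5) D(3,4)] by simp
    next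
      case False
      have "D \<inter> D' \<subseteq> sierpinski_map v ` S \<inter> sierpinski_map w ` S"
        using D \<C>(2) by blast
      then show ?thesis using pairwiseD[OF fin D(1,2) False] finite_subset by blast
    qed
  qed
  ultimately show ?case by blast
qed

lemma sierpinski_attractor_finite_frontier_nbhd:
  fixes V :: "'a::real_normed_vector set"
  assumes "is_sierpinski_attractor V S" "finite V"
    and "pairwise (\<lambda>v w. finite (sierpinski_map v ` S \<inter> sierpinski_map w ` S)) V"
    and x: "x \<in> S" and e: "0 < e"
  shows "\<exists>U. openin (top_of_set S) U \<and> x \<in> U \<and> U \<subseteq> ball x e \<and> finite (top_of_set S frontier_of U)"
proof -
  obtain n where n: "diameter S / e < 2 ^ n"
    using real_arch_pow[of 2] by auto
  obtain \<C> where \<C>: "finite \<C>" "\<Union>\<C> = S" "\<And>C. C \<in> \<C> \<Longrightarrow> compact C"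
    "\<And>C x y. C \<in> \<C> \<Longrightarrow> x \<in> C \<Longrightarrow> y \<in> C \<Longrightarrow> dist x y \<le> diameter S / 2 ^ n"
    "pairwise (\<lambda>C C'. finite (C \<inter> C')) \<C>"
    using sierpinski_attractor_cells[OF assms(1-3), of n] by metis
  \<comment> \<open>The neighbourhood is \<open>S - R\<close>, not \<open>N\<close>:
    \<open>S - R\<close> is open since \<open>R\<close> is closed, while the closed set
    \<open>N\<close> traps its closure. The frontier therefore lies in
    \<open>N \<inter> R\<close>.\<close>
  define N where "N = \<Union>{C\<in>\<C>. x \<in> C}"
  define R where "R = \<Union>{C\<in>\<C>. x \<notin> C}"
  have cl: "closed N" "closed R"
    unfolding N_def R_def using \<C> by (auto intro!: closed_Union compact_imp_closed)
  have NR: "N \<union> R = S" using \<C>(2) by (auto simp: N_def R_def)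
  have op: "openin (top_of_set S) (S - R)"
    using cl(2) by (simp add: Diff_eq openin_open_Int open_Compl)
  have "diameter S / 2 ^ n < e"
    using n e by (simp add: field_simps)
  have "N \<subseteq> ball x e"
  proof
    fix y assume "y \<in> N"
    then obtain C where "C \<in> \<C>" "x \<in> C" "y \<in> C" by (auto simp: N_def)
    from \<C>(4)[OF this] \<open>diameter S / 2 ^ n < e\<close> show "y \<in> ball x e" by simp
  qed
  have "closedin (top_of_set S) N"
    using cl(1) NR by (intro closed_subset) auto
  then have "top_of_set S closure_of (S - R) \<subseteq> N"
    using NR by (intro closure_of_minimal) auto
  then have "top_of_set S frontier_of (S - R) \<subseteq> N \<inter> R"
    using NR interior_of_openin[OF op] by (auto simp: frontier_of_def)
  also have "\<dots> = (\<Union>C\<in>{C\<in>\<C>. x \<in> C}. \<Union>C'\<in>{C\<in>\<C>. x \<notin> C}. C \<inter> C')"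
    by (auto simp: N_def R_def)
  finally have "top_of_set S frontier_of (S - R) \<subseteq> \<dots>" .
  moreover have "finite (C \<inter> C')" if "C \<in> {C\<in>\<C>. x \<in> C}" "C' \<in> {C\<in>\<C>. x \<notin> C}" for C C'
    using that pairwiseD[OF \<C>(5), of C C'] by blast
  ultimately have "finite (top_of_set S frontier_of (S - R))"
    using \<C>(1) by (elim finite_subset) (intro finite_UN_I; simp)
  moreover have "x \<in> S - R" using x by (auto simp: R_def)
  ultimately show ?thesis
    using op NR \<open>N \<subseteq> ball x e\<close> by (intro exI[of _ "S - R"]) auto
qed

section \<open>First-level cells of an equilateral triangle meet in at most one point\<close>

text \<open>This is the law of cosines with all sides equal.\<close>

lemma inner_equilateral:
  fixes a b c :: "'a::real_inner"
  assumes "dist a b = dist b c" "dist b c = dist c a"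
  shows "(a - b) \<bullet> (a - c) = (dist a b)\<^sup>2 / 2"
proof -
  have "(dist b c)\<^sup>2 = (dist a b)\<^sup>2 + (dist c a)\<^sup>2 - 2 * ((a - b) \<bullet> (a - c))"
    by (simp add: dist_norm power2_norm_eq_inner inner_diff inner_commute)
  with assms show ?thesis by simp
qed

text \<open>
  The quantity bounded here is a multiple of \<open>1 - \<beta>\<close>, where \<open>\<beta>\<close> is the barycentric coordinate
  belonging to \<open>a\<close>: it vanishes at \<open>a\<close> and is \<open>3/2 * (dist a b)\<^sup>2\<close> at \<open>b\<close> and \<open>c\<close>.
\<close>

lemma sierpinski_attractor_height_le:
  fixes a b c :: "'a::real_inner"
  assumes "is_sierpinski_attractor {a, b, c} S"
    and eq: "dist a b = dist b c" "dist b c = dist c a"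
    and "x \<in> S"
  shows "(a - x) \<bullet> (2 *\<^sub>R a - b - c) \<le> 3/2 * (dist a b)\<^sup>2"
proof -
  define h where "h y = (a - y) \<bullet> (2 *\<^sub>R a - b - c)" for y
  have S: "S \<noteq> {}" "compact S" "S = (\<Union>v\<in>{a, b, c}. sierpinski_map v ` S)"
    using assms(1) unfolding is_sierpinski_attractor_def by blast+
  have *: "2 *\<^sub>R a - b - c = (a - b) + (a - c)" by (simp add: scaleR_2)
  have "h a = 0" by (simp add: h_def)
  moreover have "h b = 3/2 * (dist a b)\<^sup>2"
    unfolding h_def * inner_add_right inner_equilateral[OF eq]
    by (simp add: dist_norm power2_norm_eq_inner)
  moreover have "h c = 3/2 * (dist a b)\<^sup>2"
    unfolding h_def * inner_add_right inner_commute[of "a - c" "a - b"] inner_equilateral[OF eq]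
    using eq by (simp add: dist_norm norm_minus_commute flip: power2_norm_eq_inner)
  ultimately have hV: "h v \<le> 3/2 * (dist a b)\<^sup>2" if "v \<in> {a, b, c}" for v
    using that by auto
  have "continuous_on S h" unfolding h_def by (intro continuous_intros)
  then obtain m where m: "m \<in> S" "\<And>y. y \<in> S \<Longrightarrow> h y \<le> h m"
    using continuous_attains_sup[OF S(2,1)] by blast
  obtain v y where v: "v \<in> {a, b, c}" "y \<in> S" "m = sierpinski_map v y"
    using m(1) S(3) by blast
  \<comment> \<open>\<open>h\<close> is affine and \<open>m\<close> is the midpoint of
    \<open>y\<close> and \<open>v\<close>, so \<open>h m\<close> is the mean of \<open>h y\<close>
    and \<open>h v\<close>. Maximality gives \<open>h y \<le> h m\<close>, hence
    \<open>h m \<le> h v\<close>.\<close>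
  have "a - m = (1/2) *\<^sub>R ((a - y) + (a - v))"
    by (simp add: v(3) sierpinski_map_def algebra_simps flip: scaleR_2)
  then have "h m = (h y + h v) / 2"
    by (simp add: h_def inner_add_left)
  with m(2)[OF v(2)] hV[OF v(1)] have "h m \<le> 3/2 * (dist a b)\<^sup>2"
    by (simp add: field_simps)
  with m(2)[OF assms(4)] have "h x \<le> 3/2 * (dist a b)\<^sup>2"
    by (rule order_trans)
  then show ?thesis by (simp only: h_def)
qed

text \<open>The Gram determinant of \<open>p\<close> and \<open>q\<close> is
  \<open>3/4 * s\<^sup>2\<close>, so they are linearly independent; Cramer's rule recovers the
  coordinates of \<open>d\<close>.\<close>

lemma orthogonal_equilateral_imp_0:
  fixes p q d :: "real^2"
  assumes "p \<bullet> p = s" "q \<bullet> q = s" "p \<bullet> q = s / 2" "s > 0" "d \<bullet> p = 0" "d \<bullet> q = 0"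
  shows "d = 0"
proof -
  define D where "D = p$1 * q$2 - p$2 * q$1"
  have "D\<^sup>2 = (p \<bullet> p) * (q \<bullet> q) - (p \<bullet> q)\<^sup>2"
    by (simp add: D_def inner_vec_def sum_2 power2_eq_square algebra_simps)
  also have "\<dots> = 3/4 * s\<^sup>2" unfolding assms(1-3) by (simp add: power2_eq_square)
  finally have "D \<noteq> 0" using assms(4) by auto
  have "d$1 * D = (d \<bullet> p) * q$2 - (d \<bullet> q) * p$2" "d$2 * D = (d \<bullet> q) * p$1 - (d \<bullet> p) * q$1"
    by (simp_all add: D_def inner_vec_def sum_2 algebra_simps)
  with assms \<open>D \<noteq> 0\<close> show ?thesis by (simp add: vec_eq_iff forall_2)
qed

text \<open>In the cell at \<open>a\<close> the barycentric coordinate of \<open>a\<close> is at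
  least 1/2, and likewise for \<open>b\<close>. Since the coordinate of \<open>c\<close> is
  non-negative and all three add up to 1, only the midpoint of \<open>a\<close> and \<open>b\<close>
  can be common to both cells.\<close>

lemma finite_sierpinski_cells_Int:
  fixes a b c :: "real^2"
  assumes S: "is_sierpinski_attractor {a, b, c} S"
    and "a \<noteq> b" and eq: "dist a b = dist b c" "dist b c = dist c a"
  shows "finite (sierpinski_map a ` S \<inter> sierpinski_map b ` S)"
proof -
  define s where "s = (dist a b)\<^sup>2"
  define h where "h v w u x = (v - x) \<bullet> (2 *\<^sub>R v - w - u)" for v w u x :: "real^2"
  have S': "is_sierpinski_attractor {b, c, a} S" "is_sierpinski_attractor {c, a, b} S"
    using S by (simp_all add: insert_commute)
  have h_le: "h a b c x \<le> 3/2 * s" "h b c a x \<le> 3/2 * s" "h c a b x \<le> 3/2 * s" if "x \<in> S" for x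
    using sierpinski_attractor_height_le[OF S eq that]
      sierpinski_attractor_height_le[OF S'(1) eq(2) _ that]
      sierpinski_attractor_height_le[OF S'(2) _ eq(1) that]
    unfolding h_def s_def eq by blast+
  \<comment> \<open>The map contracts by 1/2 towards its fixed point \<open>v\<close>, where
    \<open>h\<close> vanishes.\<close>
  have h_map: "h v w u (sierpinski_map v y) = h v w u y / 2" for v w u y
  proof -
    have "v - sierpinski_map v y = (1/2) *\<^sub>R (v - y)"
      by (simp add: sierpinski_map_def algebra_simps flip: scaleR_2)
    then show ?thesis by (simp add: h_def)
  qed
  have ab: "(a - b) \<bullet> (a - b) = s" and ac: "(a - c) \<bullet> (a - c) = s" and abc: "(a - b) \<bullet> (a - c) = s/2"
    using inner_equilateral[OF eq] eq
    by (simp_all add: s_def dist_norm norm_minus_commute flip: power2_norm_eq_inner)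
  \<comment> \<open>The three direction vectors add up to 0, so \<open>x\<close> cancels. The upper
    bounds \<open>3/4 * s\<close>, \<open>3/4 * s\<close> and \<open>3/2 * s\<close> add up to
    exactly this total, so all of them are attained.\<close>
  have h_sum: "h a b c x + h b c a x + h c a b x = 3 * s" for x
  proof -
    have "h a b c x + h b c a x + h c a b x =
      2 * ((a - b) \<bullet> (a - b) + (a - c) \<bullet> (a - c) - (a - b) \<bullet> (a - c))"
      by (simp add: h_def inner_diff inner_commute algebra_simps)
    then show ?thesis by (simp only: ab ac abc) simp
  qed
  have h_eq: "h a b c x = 3/4 * s \<and> h b c a x = 3/4 * s"
    if x: "x \<in> sierpinski_map a ` S \<inter> sierpinski_map b ` S" for x
  proof -
    obtain y z where "y \<in> S" "z \<in> S" "x = sierpinski_map a y" "x = sierpinski_map b z"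
      using x by blast
    moreover from this have "x \<in> S"
      using S unfolding is_sierpinski_attractor_def by blast
    ultimately have "h a b c x \<le> 3/4 * s" "h b c a x \<le> 3/4 * s" "h c a b x \<le> 3/2 * s"
      using h_map[of a b c y] h_map[of b c a z] h_le(1)[of y] h_le(2)[of z] h_le(3)[of x] by auto
    with h_sum[of x] show ?thesis by linarith
  qed
  have "x = y"
    if x: "x \<in> sierpinski_map a ` S \<inter> sierpinski_map b ` S"
      and y: "y \<in> sierpinski_map a ` S \<inter> sierpinski_map b ` S" for x y
  proof -
    \<comment> \<open>Both left sides are 0, and subtracting the two equations isolates the inner
      product with \<open>a - b\<close>.\<close>
    have "h a b c x - h a b c y = - ((x - y) \<bullet> (a - b)) - (x - y) \<bullet> (a - c)"
      "h b c a x - h b c a y = 2 * ((x - y) \<bullet> (a - b)) - (x - y) \<bullet> (a - c)"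
      by (simp_all add: h_def inner_diff inner_commute algebra_simps)
    with h_eq[OF x] h_eq[OF y] have "(x - y) \<bullet> (a - b) = 0" "(x - y) \<bullet> (a - c) = 0"
      by simp_all
    with orthogonal_equilateral_imp_0[OF ab ac abc, of "x - y"] \<open>a \<noteq> b\<close>
    show ?thesis by (simp add: s_def)
  qed
  then have "\<exists>x. sierpinski_map a ` S \<inter> sierpinski_map b ` S \<subseteq> {x}" by blast
  then show ?thesis by (auto elim: finite_subset)
qed

theorem theorem5p1:
  fixes v1 v2 v3 :: "real^2"
  assumes "v1 \<noteq> v2" and "dist v1 v2 = dist v2 v3" and "dist v2 v3 = dist v3 v1"
  shows "topological_hausdorff_dim (sierpinski_triangle v1 v2 v3) = 1"
proof (rule antisym)
  define S where "S = sierpinski_triangle v1 v2 v3"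
  have S: "is_sierpinski_attractor {v1, v2, v3} S"
    unfolding S_def by (rule sierpinski_triangle_attractor)
  then have S': "is_sierpinski_attractor {v2, v3, v1} S" "is_sierpinski_attractor {v3, v1, v2} S"
    by (simp_all add: insert_commute)
  have eq: "dist v3 v1 = dist v1 v2" using assms by simp
  then have ne: "v2 \<noteq> v3" "v3 \<noteq> v1" using assms by auto
  \<comment> \<open>The intersection lemma treats one pair of vertices; cyclic rotation of the
    triangle supplies the other two.\<close>
  have "pairwise (\<lambda>v w. finite (sierpinski_map v ` S \<inter> sierpinski_map w ` S)) {v1, v2, v3}"
    using finite_sierpinski_cells_Int[OF S assms]
      finite_sierpinski_cells_Int[OF S'(1) ne(1) assms(3) eq]
      finite_sierpinski_cells_Int[OF S'(2) ne(2) eq assms(2)]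
    by (auto simp: pairwise_insert Int_commute)
  then show "topological_hausdorff_dim (sierpinski_triangle v1 v2 v3) \<le> 1"
    unfolding S_def[symmetric]
    by (intro topological_hausdorff_dim_le_1 sierpinski_attractor_finite_frontier_nbhd[OF S]) auto
  have "closed_segment v1 v2 \<subseteq> S"
    using closed_segment_subset_sierpinski_maps[of v1 v2]
    by (intro compact_subset_sierpinski_attractor[OF S]) auto
  then show "1 \<le> topological_hausdorff_dim (sierpinski_triangle v1 v2 v3)"
    unfolding S_def
    \<comment> \<open>\<open>rotated\<close> makes \<open>K \<subseteq> X\<close> the first premise,
      so that the chained inclusion instantiates \<open>K\<close> with the segment.\<close>
    by (rule topological_hausdorff_dim_ge_1[where a = v1 and b = v2, rotated]) (use assms in auto)
qed

end
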